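(* Suppose $\operatorname{char}(K)=0$. Let $I\subseteq R$ be an ideal generated in degrees $\le d$ such that $\operatorname{in}(I)$ is strongly stable and has $q$ minimal generators in degree $d+1$. Then for all $k\ge1$ we have $$\dim_K I_{d+k}\ \le\ q\binom{n-1+k-1}{n-1}+\dim_K R_k\operatorname{in}(I)_d.$$
   Context: $K$ is a field, $n\ge 3$, $R=K[x_1,\dots,x_n]$ is standard graded, and all ideals are homogeneous; the subscript $d$ denotes the degree-$d$ component, and $R_k\operatorname{in}(I)_d$ is the span of products of elements of $R_k$ and $\operatorname{in}(I)_d$. $\operatorname{in}(I)$ is the initial ideal with respect to the reverse lexicographic order: for monomials of the same degree, $x^p>x^q$ if the last nonzero entry of $p-q$ is negative. A monomial ideal (or set of monomials) is strongly stable if for every monomial $m$ in it, every $j$ with $x_j\mid m$ and every $i<j$, the monomial $x_im/x_j$ is also in it. *)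

theory Defs
  imports Complex_Main "HOL-Library.Cardinality" "HOL-Library.Poly_Mapping"
begin

text \<open>
  The variables \<open>x\<^sub>1, \<dots>, x\<^sub>n\<close> are indexed by a finite linearly ordered type \<open>'n\<close> with
  \<open>n = CARD('n)\<close>; monomials are exponent vectors, and the product of polynomials is the
  convolution product of \<^theory>\<open>HOL-Library.Poly_Mapping\<close>.
\<close>

type_synonym 'n mon = "'n \<Rightarrow>\<^sub>0 nat"
type_synonym ('n, 'k) mpoly = "'n mon \<Rightarrow>\<^sub>0 'k"

abbreviation monom :: "'n mon \<Rightarrow> ('n, 'k::field) mpoly" where
  "monom m \<equiv> Poly_Mapping.single m 1"

definition mscale :: "'k \<Rightarrow> ('n, 'k::field) mpoly \<Rightarrow> ('n, 'k) mpoly" where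
  "mscale c p = Poly_Mapping.single 0 c * p"

global_interpretation mpoly: vector_space mscale
  by unfold_locales
    (simp_all add: mscale_def single_add distrib_left distrib_right mult_single
      flip: mult.assoc)

text \<open>
  The ring as a module over itself: \<open>ideal.subspace I\<close> says that \<open>I\<close> is an ideal, and
  \<open>ideal.span S\<close> is the ideal generated by \<open>S\<close>.
\<close>

global_interpretation ideal: module "(*) :: ('n, 'k::field) mpoly \<Rightarrow> ('n, 'k) mpoly \<Rightarrow> ('n, 'k) mpoly"
  by unfold_locales (simp_all add: algebra_simps)

definition mdeg :: "'n::finite mon \<Rightarrow> nat" where
  "mdeg m = (\<Sum>i\<in>UNIV. Poly_Mapping.lookup m i)"

definition R_deg :: "nat \<Rightarrow> ('n::finite, 'k::field) mpoly set" where
  "R_deg e = {f. \<forall>m\<in>Poly_Mapping.keys f. mdeg m = e}"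

definition homogeneous_ideal :: "('n::finite, 'k::field) mpoly set \<Rightarrow> bool" where
  "homogeneous_ideal I \<longleftrightarrow> (\<exists>S \<subseteq> (\<Union>e. R_deg e). I = ideal.span S)"

definition generated_in_degrees_le :: "nat \<Rightarrow> ('n::finite, 'k::field) mpoly set \<Rightarrow> bool" where
  "generated_in_degrees_le d I \<longleftrightarrow> (\<exists>S \<subseteq> (\<Union>e\<le>d. R_deg e). I = ideal.span S)"

definition deg_part :: "('n::finite, 'k::field) mpoly set \<Rightarrow> nat \<Rightarrow> ('n, 'k) mpoly set" where
  "deg_part I e = I \<inter> R_deg e"

text \<open>
  \<open>revlex_less q p\<close> means \<open>x\<^sup>p > x\<^sup>q\<close>. The degrees are not compared, so the relation is
  meant for monomials of the same degree.
\<close>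

definition revlex_less :: "'n::linorder mon \<Rightarrow> 'n mon \<Rightarrow> bool" where
  "revlex_less q p \<longleftrightarrow>
     (\<exists>j. Poly_Mapping.lookup p j < Poly_Mapping.lookup q j \<and>
       (\<forall>i>j. Poly_Mapping.lookup p i = Poly_Mapping.lookup q i))"

definition initial_mon :: "('n::linorder, 'k::field) mpoly \<Rightarrow> 'n mon" where
  "initial_mon f =
     (THE m. m \<in> Poly_Mapping.keys f \<and>
       (\<forall>m'\<in>Poly_Mapping.keys f. m' \<noteq> m \<longrightarrow> revlex_less m' m))"

text \<open>
  As the order compares monomials of the same degree, only homogeneous elements are used. For a
  homogeneous ideal this gives the same ideal as all nonzero elements and the graded order.
\<close>

definition initial_ideal :: "('n::{finite,linorder}, 'k::field) mpoly set \<Rightarrow> ('n, 'k) mpoly set" where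
  "initial_ideal I = ideal.span {monom (initial_mon f) | f e. f \<in> deg_part I e \<and> f \<noteq> 0}"

definition strongly_stable :: "('n::linorder, 'k::field) mpoly set \<Rightarrow> bool" where
  "strongly_stable J \<longleftrightarrow>
     (\<forall>m i j. monom m \<in> J \<and> Poly_Mapping.lookup m j > 0 \<and> i < j \<longrightarrow>
        monom (m + Poly_Mapping.single i 1 - Poly_Mapping.single j 1) \<in> J)"

text \<open>For a monomial ideal \<open>J\<close> exactly one set \<open>G\<close> of monomials has this property.\<close>

definition minimal_generators :: "('n, 'k::field) mpoly set \<Rightarrow> 'n mon set \<Rightarrow> bool" where
  "minimal_generators J G \<longleftrightarrow>
     ideal.span (monom ` G) = J \<and> (\<forall>H. H \<subset> G \<longrightarrow> ideal.span (monom ` H) \<noteq> J)"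

end

theory Submission
  imports Defs
begin

text \<open>
  Write \<open>J\<close> for the initial ideal of \<open>I\<close>, and \<open>M\<close> for the set of monomials of degree \<open>d\<close> in \<open>J\<close>.
  Choose for each \<open>m \<in> M\<close> a monic form \<open>F m \<in> I\<close> with initial monomial \<open>m\<close>. As \<open>I\<close> is generated in
  degrees \<open>\<le> d\<close>, the products \<open>u * F m\<close> with \<open>u\<close> a monomial of degree \<open>k\<close> span the part of \<open>I\<close> of
  degree \<open>d + k\<close>, but with repetitions: different pairs \<open>(u, m)\<close> can have the same product monomial.

  The repetitions are governed by the syzygies of \<open>M\<close>, and stability makes these linear: if a
  variable \<open>x\<^sub>i\<close> of \<open>u\<close> precedes a variable \<open>x\<^sub>j\<close> of \<open>m\<close>, then \<open>m' = x\<^sub>i m / x\<^sub>j\<close> is again in \<open>M\<close> and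
  \<open>x\<^sub>i m = x\<^sub>j m'\<close>. Such swaps turn every pair into one where all variables of \<open>m\<close> come before or
  coincide with those of \<open>u\<close>. Such a sorted pair is determined by its product, since \<open>m\<close> consists of
  the first \<open>d\<close> factors of \<open>u m\<close> (\<open>inj_on_sorted_pairs\<close>); hence there are at most as many sorted pairs
  as monomials in \<open>R\<^sub>k J\<^sub>d\<close>.

  For the forms, a swap has an error term \<open>x\<^sub>i F m - x\<^sub>j F m'\<close>. It is an element of \<open>I\<close> of degree
  \<open>d + 1\<close> and, unless it is zero, has an initial monomial smaller than \<open>x\<^sub>i m\<close>. It therefore expands into products
  \<open>x\<^sub>l F m''\<close> with smaller product monomials, and into forms \<open>H v\<close> chosen for the monomials \<open>v\<close> of
  degree \<open>d + 1\<close> in \<open>J\<close> outside \<open>R\<^sub>1 J\<^sub>d\<close>. Each such \<open>v\<close> is a minimal generator of \<open>J\<close>, so there are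
  at most \<open>q\<close> of them. By induction along the monomial order, the sorted products together with the
  multiples of the \<open>H v\<close> by monomials of degree \<open>k - 1\<close> span everything
  (\<open>product_in_span_sorted\<close>). Counting these two families gives the two summands of the bound.
  In terms of modules: the syzygies of \<open>J\<^sub>d\<close> are generated by linear ones, and modulo the initial
  parts of the syzygies of \<open>I\<^sub>d\<close> at most \<open>q\<close> of these are enough.
\<close>

section \<open>Monomials\<close>

abbreviation lookup :: "('a \<Rightarrow>\<^sub>0 'b::zero) \<Rightarrow> 'a \<Rightarrow> 'b" where
  "lookup \<equiv> Poly_Mapping.lookup"

abbreviation keys :: "('a \<Rightarrow>\<^sub>0 'b::zero) \<Rightarrow> 'a set" where
  "keys \<equiv> Poly_Mapping.keys"

abbreviation var :: "'n \<Rightarrow> 'n mon" where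
  "var i \<equiv> Poly_Mapping.single i 1"

definition monomials :: "nat \<Rightarrow> 'n::finite mon set" where
  "monomials e = {m. mdeg m = e}"

lemma mdeg_plus [simp]: "mdeg (a + b) = mdeg a + mdeg b"
  by (simp add: mdeg_def lookup_add sum.distrib)

lemma mdeg_zero [simp]: "mdeg 0 = 0"
  by (simp add: mdeg_def)

lemma mdeg_single [simp]: "mdeg (Poly_Mapping.single i c) = c"
  by (simp add: mdeg_def lookup_single when_def)

lemma var_plus_minus_var:
  assumes "j \<in> keys m"
  shows "m - var j + var j = (m :: 'n mon)"
  using assms by (intro poly_mapping_eqI) (auto simp: lookup_add lookup_minus lookup_single when_def in_keys_iff)

lemma exists_divisor_of_degree:
  assumes "a \<le> mdeg (m :: 'n::finite mon)"
  obtains u v where "m = u + v" "mdeg u = a"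
proof -
  have "\<exists>u v. m = u + v \<and> mdeg u = a"
    using assms
  proof (induction a)
    case 0
    show ?case by (intro exI[of _ 0] exI[of _ m]) simp
  next
    case (Suc a)
    then obtain u v where uv: "m = u + v" "mdeg u = a" by auto
    with Suc.prems have "v \<noteq> 0" by auto
    then obtain j where j: "j \<in> keys v" by fastforce
    have "m = (u + var j) + (v - var j)"
      using uv(1) var_plus_minus_var[OF j] by (simp add: ac_simps)
    moreover have "mdeg (u + var j) = Suc a" using uv by simp
    ultimately show ?case by blast
  qed
  then show ?thesis using that by blast
qed

text \<open>
  Stars and bars: a monomial is determined by the list of its exponents,
  and the lists of given length and sum are counted by a binomial coefficient.
\<close>

lemma finite_monomials [simp]: "finite (monomials e :: 'n::finite mon set)"
  and card_monomials_le: "card (monomials e :: 'n::finite mon set) \<le> (e + CARD('n) - 1) choose e"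
proof -
  obtain xs :: "'n list" where xs: "set xs = UNIV" "distinct xs"
    using finite_distinct_list[of "UNIV :: 'n set"] by auto
  define L where "L = {l :: nat list. length l = CARD('n) \<and> sum_list l = e}"
  have "L \<subseteq> {l. set l \<subseteq> {..e} \<and> length l = CARD('n)}"
    by (auto simp: L_def member_le_sum_list)
  then have fin: "finite L"
    by (rule finite_subset) (simp add: finite_lists_length_eq)
  have inj: "inj_on (\<lambda>m. map (lookup m) xs) (monomials e)"
    using xs by (auto intro!: inj_onI poly_mapping_eqI)
  have im: "(\<lambda>m. map (lookup m) xs) ` monomials e \<subseteq> L"
    using xs distinct_card[OF xs(2)]
    by (auto simp: L_def monomials_def mdeg_def sum_list_distinct_conv_sum_set)
  show "finite (monomials e :: 'n mon set)"
    using inj im fin by (rule inj_on_finite)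
  show "card (monomials e :: 'n mon set) \<le> (e + CARD('n) - 1) choose e"
    using card_inj_on_le[OF inj im fin] by (simp add: L_def card_length_sum_list)
qed

lemma revlex_less_irrefl [simp]: "\<not> revlex_less a a"
  by (simp add: revlex_less_def)

lemma revlex_less_trans:
  assumes "revlex_less a b" "revlex_less b c"
  shows "revlex_less a c"
proof -
  obtain j where j: "lookup b j < lookup a j" "\<forall>i>j. lookup b i = lookup a i"
    using assms(1) unfolding revlex_less_def by blast
  obtain l where l: "lookup c l < lookup b l" "\<forall>i>l. lookup c i = lookup b i"
    using assms(2) unfolding revlex_less_def by blast
  have "lookup c (max j l) < lookup a (max j l) \<and> (\<forall>i>max j l. lookup c i = lookup a i)"
    using j l by (cases j l rule: linorder_cases) (auto simp: max_def)
  then show ?thesis unfolding revlex_less_def by blast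
qed

lemma revlex_less_total:
  fixes a b :: "'n::{finite,linorder} mon"
  assumes "a \<noteq> b"
  shows "revlex_less a b \<or> revlex_less b a"
proof -
  define D where "D = {i. lookup a i \<noteq> lookup b i}"
  have "D \<noteq> {}" using assms by (auto simp: D_def intro: poly_mapping_eqI)
  then have j: "Max D \<in> D" and above: "\<And>i. i > Max D \<Longrightarrow> i \<notin> D"
    by (auto dest: leD[OF Max_ge[OF finite]])
  then show ?thesis
    unfolding revlex_less_def D_def by (metis (mono_tags, lifting) linorder_neqE_nat mem_Collect_eq)
qed

lemma revlex_less_plus [simp]: "revlex_less (u + a) (u + b) \<longleftrightarrow> revlex_less a b"
  by (simp add: revlex_less_def lookup_add)

text \<open>A swap moves the second monomial of a pair up, which makes the rewriting terminate.\<close>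

lemma revlex_less_shift:
  assumes "i < j" "j \<in> keys m"
  shows "revlex_less m (m + var i - var j)"
  using assms unfolding revlex_less_def
  by (intro exI[of _ j]) (auto simp: lookup_add lookup_minus lookup_single when_def in_keys_iff)

text \<open>
  Among the finitely many monomials of one degree, these two numbers make induction along the
  order and along its converse an induction on natural numbers.
\<close>

definition below :: "'n::{finite,linorder} mon \<Rightarrow> nat" where
  "below m = card {a \<in> monomials (mdeg m). revlex_less a m}"

definition above :: "'n::{finite,linorder} mon \<Rightarrow> nat" where
  "above m = card {a \<in> monomials (mdeg m). revlex_less m a}"

lemma below_less:
  assumes "revlex_less a b" "mdeg a = mdeg b"
  shows "below a < below b"
proof -
  have "{x \<in> monomials (mdeg a). revlex_less x a} \<subseteq> {x \<in> monomials (mdeg b). revlex_less x b}"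
    using assms by (auto intro: revlex_less_trans)
  moreover have "a \<in> {x \<in> monomials (mdeg b). revlex_less x b}"
    using assms by (simp add: monomials_def)
  moreover have "a \<notin> {x \<in> monomials (mdeg a). revlex_less x a}" by simp
  ultimately show ?thesis
    unfolding below_def by (intro psubset_card_mono) (simp, blast)
qed

lemma above_less:
  assumes "revlex_less a b" "mdeg a = mdeg b"
  shows "above b < above a"
proof -
  have "{x \<in> monomials (mdeg b). revlex_less b x} \<subseteq> {x \<in> monomials (mdeg a). revlex_less a x}"
    using assms by (auto intro: revlex_less_trans)
  moreover have "b \<in> {x \<in> monomials (mdeg a). revlex_less a x}"
    using assms by (simp add: monomials_def)
  moreover have "b \<notin> {x \<in> monomials (mdeg b). revlex_less b x}" by simp
  ultimately show ?thesis
    unfolding above_def by (intro psubset_card_mono) (simp, blast)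
qed

section \<open>Polynomials\<close>

lemma lookup_monom_mult: "lookup (Poly_Mapping.single u c * f) (u + m) = c * lookup (f :: ('n, 'k::field) mpoly) m"
  by (simp add: lookup_mult lookup_single when_mult)

lemma lookup_mscale [simp]: "lookup (mscale c f) m = c * lookup f m"
  using lookup_monom_mult[of 0 c f m] by (simp add: mscale_def)

lemma keys_monom_mult: "keys (monom u * f) = (+) u ` keys (f :: ('n, 'k::field) mpoly)"
proof
  show "keys (monom u * f) \<subseteq> (+) u ` keys f"
    using keys_mult[of "monom u" f] by auto
  show "(+) u ` keys f \<subseteq> keys (monom u * f)"
    by (auto simp: in_keys_iff lookup_monom_mult)
qed

lemma mult_mscale: "g * mscale c f = mscale c (g * f)"
  unfolding mscale_def by (rule mult.left_commute)

lemma poly_eq_sum_monom: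
  "(f :: ('n, 'k::field) mpoly) = (\<Sum>m\<in>keys f. mscale (lookup f m) (monom m))"
  by (rule poly_mapping_eqI)
    (simp add: lookup_sum lookup_single when_def in_keys_iff if_distrib[of "(*) _"] cong: if_cong)

lemma span_monom: "mpoly.span (monom ` A) = {f :: ('n, 'k::field) mpoly. keys f \<subseteq> A}"
proof
  have "mpoly.subspace {f :: ('n, 'k) mpoly. keys f \<subseteq> A}"
    unfolding mpoly.subspace_def
    by (auto simp: subset_iff in_keys_iff lookup_add) (metis add_0)
  then show "mpoly.span (monom ` A) \<subseteq> {f :: ('n, 'k) mpoly. keys f \<subseteq> A}"
    by (intro mpoly.span_minimal) auto
  show "{f :: ('n, 'k) mpoly. keys f \<subseteq> A} \<subseteq> mpoly.span (monom ` A)"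
  proof
    fix f :: "('n, 'k) mpoly" assume "f \<in> {f. keys f \<subseteq> A}"
    then have "(\<Sum>m\<in>keys f. mscale (lookup f m) (monom m)) \<in> mpoly.span (monom ` A)"
      by (intro mpoly.span_sum mpoly.span_scale mpoly.span_base) auto
    then show "f \<in> mpoly.span (monom ` A)"
      using poly_eq_sum_monom[of f] by simp
  qed
qed

lemma independent_monom: "mpoly.independent (monom ` A :: ('n, 'k::field) mpoly set)"
proof
  assume "mpoly.dependent (monom ` A :: ('n, 'k) mpoly set)"
  then obtain a where "a \<in> A" "(monom a :: ('n, 'k) mpoly) \<in> mpoly.span (monom ` A - {monom a})"
    unfolding mpoly.dependent_def by blast
  moreover have "monom ` A - {monom a :: ('n, 'k) mpoly} \<subseteq> monom ` (A - {a})"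
    by auto
  ultimately have "(monom a :: ('n, 'k) mpoly) \<in> mpoly.span (monom ` (A - {a}))"
    using mpoly.span_mono by blast
  then show False by (simp add: span_monom)
qed

lemma dim_span_monom: "mpoly.dim (mpoly.span (monom ` A :: ('n, 'k::field) mpoly set)) = card A"
proof -
  have "inj_on (monom :: 'n mon \<Rightarrow> ('n, 'k) mpoly) A"
    by (rule inj_onI) (metis keys_single one_neq_zero singleton_inject)
  then show ?thesis
    using mpoly.dim_span_eq_card_independent[OF independent_monom] card_image by metis
qed

lemma mult_span:
  assumes "f \<in> mpoly.span B" "\<And>b. b \<in> B \<Longrightarrow> g * b \<in> mpoly.span C"
  shows "g * f \<in> mpoly.span C"
  using assms(1)
  by (induction rule: mpoly.span_induct_alt)
    (auto simp: distrib_left mult_mscale mpoly.span_zero assms(2) intro!: mpoly.span_add mpoly.span_scale)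

text \<open>Coefficients from the ring are split into monomials, to pass from modules to vector spaces.\<close>

lemma ideal_span_eq_span:
  "ideal.span S = mpoly.span {monom u * s | u s. s \<in> S}" (is "_ = mpoly.span ?T")
proof
  show "ideal.span S \<subseteq> mpoly.span ?T"
  proof
    fix f assume "f \<in> ideal.span S"
    then show "f \<in> mpoly.span ?T"
    proof (induction rule: ideal.span_induct_alt)
      case base
      show ?case by (rule mpoly.span_zero)
    next
      case (step c x y)
      have "c \<in> mpoly.span (range monom)" by (simp add: span_monom)
      then have "x * c \<in> mpoly.span ?T"
        by (rule mult_span) (use step in \<open>auto simp: mult.commute[of x] intro!: mpoly.span_base\<close>)
      with step show ?case by (simp add: mult.commute mpoly.span_add)
    qed
  qed
  have "mpoly.subspace (ideal.span S)"
    unfolding mpoly.subspace_def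
    by (auto simp: mscale_def ideal.span_zero intro: ideal.span_add ideal.span_scale)
  then show "mpoly.span ?T \<subseteq> ideal.span S"
    by (intro mpoly.span_minimal) (auto intro: ideal.span_scale ideal.span_base)
qed

lemma keys_in_monomial_ideal:
  assumes "f \<in> ideal.span (monom ` A)" "m \<in> keys f"
  obtains u a where "a \<in> A" "m = u + a"
proof -
  have "f \<in> mpoly.span (monom ` {u + a | u a. a \<in> A})"
  proof -
    have "{monom u * s | u s. s \<in> monom ` A} \<subseteq> (monom ` {u + a | u a. a \<in> A} :: ('a, 'b) mpoly set)"
    proof clarify
      fix u a assume "a \<in> A"
      then show "(monom u * monom a :: ('a, 'b) mpoly) \<in> monom ` {u + a | u a. a \<in> A}"
        by (intro image_eqI[of _ _ "u + a"]) (auto simp: mult_single)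
    qed
    then show ?thesis
      using assms(1) mpoly.span_mono unfolding ideal_span_eq_span by blast
  qed
  then show ?thesis using assms(2) that by (auto simp: span_monom)
qed

lemma subspace_R_deg: "mpoly.subspace (R_deg e)"
  unfolding mpoly.subspace_def R_deg_def by (auto simp: in_keys_iff lookup_add)

lemma subspace_deg_part:
  assumes "ideal.subspace I"
  shows "mpoly.subspace (deg_part I e)"
proof -
  have "mpoly.subspace I"
    using assms unfolding mpoly.subspace_def ideal.subspace_def by (auto simp: mscale_def)
  then show ?thesis
    unfolding deg_part_def using subspace_R_deg by (rule mpoly.subspace_inter)
qed

lemma monom_mult_deg_part:
  assumes "ideal.subspace I" "f \<in> deg_part I e"
  shows "monom u * f \<in> deg_part I (mdeg u + e)"
  using assms unfolding deg_part_def R_deg_def ideal.subspace_def by (auto simp: keys_monom_mult)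

definition hom_comp :: "nat \<Rightarrow> ('n::finite, 'k::field) mpoly \<Rightarrow> ('n, 'k) mpoly" where
  "hom_comp e f = Poly_Mapping.mapp (\<lambda>m c. c when mdeg m = e) f"

lemma lookup_hom_comp: "lookup (hom_comp e f) m = (lookup f m when mdeg m = e)"
  by (auto simp: hom_comp_def lookup_mapp when_def in_keys_iff)

lemma hom_comp_R_deg:
  assumes "f \<in> R_deg a"
  shows "hom_comp e f = (if a = e then f else 0)"
  using assms by (intro poly_mapping_eqI) (auto simp: lookup_hom_comp R_deg_def when_def in_keys_iff)

text \<open>Taking the component of degree \<open>e\<close> kills the generators of all other degrees.\<close>

lemma homogeneous_in_span:
  assumes "f \<in> mpoly.span T" "T \<subseteq> (\<Union>a. R_deg a)" "f \<in> R_deg e"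
  shows "f \<in> mpoly.span (T \<inter> R_deg e)"
proof -
  have "hom_comp e f \<in> mpoly.span (T \<inter> R_deg e)"
    using assms(1)
  proof (induction rule: mpoly.span_induct_alt)
    case base
    have "hom_comp e (0 :: ('a, 'b) mpoly) = 0"
      by (rule poly_mapping_eqI) (simp add: lookup_hom_comp)
    then show ?case by (simp add: mpoly.span_zero)
  next
    case (step c x y)
    have "hom_comp e (mscale c x + y) = mscale c (hom_comp e x) + hom_comp e y"
      by (rule poly_mapping_eqI) (auto simp: lookup_hom_comp lookup_add when_def)
    moreover have "hom_comp e x \<in> mpoly.span (T \<inter> R_deg e)"
    proof -
      obtain a where "x \<in> R_deg a" using step.hyps assms(2) by blast
      then show ?thesis
        using step.hyps by (auto simp: hom_comp_R_deg mpoly.span_zero intro: mpoly.span_base)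
    qed
    ultimately show ?case using step.IH by (simp add: mpoly.span_add mpoly.span_scale)
  qed
  then show ?thesis using assms(3) by (simp add: hom_comp_R_deg)
qed

text \<open>
  In a multiple \<open>u s\<close> of a generator of degree at most \<open>d\<close>, a divisor of \<open>u\<close> of degree \<open>k\<close> can be split
  off, and the rest of \<open>u\<close> lifts \<open>s\<close> to degree \<open>d\<close>.
\<close>

lemma deg_part_generated:
  assumes "generated_in_degrees_le d I" "f \<in> deg_part I (d + k)"
  shows "f \<in> mpoly.span {monom u * g | u g. mdeg u = k \<and> g \<in> deg_part I d}" (is "_ \<in> mpoly.span ?U")
proof -
  obtain S where S: "S \<subseteq> (\<Union>e\<le>d. R_deg e)" "I = ideal.span S"
    using assms(1) unfolding generated_in_degrees_le_def by blast
  have I: "ideal.subspace I" using S by simp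
  let ?T = "{monom u * s | u s. s \<in> S}"
  have T: "\<exists>e\<le>d. s \<in> deg_part I e \<and> monom u * s \<in> R_deg (mdeg u + e)" if "s \<in> S" for u s
  proof -
    obtain e where "e \<le> d" "s \<in> R_deg e" using S \<open>s \<in> S\<close> by auto
    then have "s \<in> deg_part I e" using S(2) that by (simp add: deg_part_def ideal.span_base)
    moreover from monom_mult_deg_part[OF I this] have "monom u * s \<in> R_deg (mdeg u + e)"
      by (simp add: deg_part_def)
    ultimately show ?thesis using \<open>e \<le> d\<close> by blast
  qed
  have "f \<in> mpoly.span (?T \<inter> R_deg (d + k))"
  proof (rule homogeneous_in_span)
    show "f \<in> mpoly.span ?T" "f \<in> R_deg (d + k)"
      using assms(2) S(2) ideal_span_eq_span[of S] by (auto simp: deg_part_def)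
    show "?T \<subseteq> (\<Union>a. R_deg a)" using T by fast
  qed
  moreover have "?T \<inter> R_deg (d + k) \<subseteq> mpoly.span ?U"
  proof
    fix x assume x: "x \<in> ?T \<inter> R_deg (d + k)"
    then obtain u s where us: "x = monom u * s" "s \<in> S" by blast
    obtain e where e: "e \<le> d" "s \<in> deg_part I e" "x \<in> R_deg (mdeg u + e)" using T us by blast
    show "x \<in> mpoly.span ?U"
    proof (cases "x = 0")
      case True
      then show ?thesis by (simp add: mpoly.span_zero)
    next
      case False
      then obtain m where "m \<in> keys x" by fastforce
      then have deg: "mdeg u + e = d + k" using x e(3) by (auto simp: R_deg_def)
      then have "k \<le> mdeg u" using e(1) by arith
      then obtain u1 u2 where u: "u = u1 + u2" "mdeg u1 = k"
        by (rule exists_divisor_of_degree)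
      then have "monom u2 * s \<in> deg_part I d"
        using monom_mult_deg_part[OF I e(2), of u2] deg by (simp add: add.assoc)
      moreover have "x = monom u1 * (monom u2 * s)"
        using us u by (simp add: mult_single flip: mult.assoc)
      ultimately show ?thesis using u(2) by (intro mpoly.span_base) blast
    qed
  qed
  ultimately show ?thesis
    using mpoly.span_minimal[OF _ mpoly.subspace_span] by blast
qed

section \<open>Initial monomials\<close>

lemma initial_mon_eqI:
  fixes f :: "('n::{finite,linorder}, 'k::field) mpoly"
  assumes "m \<in> keys f" "\<And>a. a \<in> keys f \<Longrightarrow> a \<noteq> m \<Longrightarrow> revlex_less a m"
  shows "initial_mon f = m"
  unfolding initial_mon_def
proof (rule the_equality)
  show "m \<in> keys f \<and> (\<forall>m'\<in>keys f. m' \<noteq> m \<longrightarrow> revlex_less m' m)" using assms by blast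
next
  fix b assume "b \<in> keys f \<and> (\<forall>m'\<in>keys f. m' \<noteq> b \<longrightarrow> revlex_less m' b)"
  then show "b = m" using assms revlex_less_trans[of b m b] revlex_less_irrefl[of b] by metis
qed

lemma initial_mon_greatest:
  fixes f :: "('n::{finite,linorder}, 'k::field) mpoly"
  assumes "f \<noteq> 0"
  shows initial_mon_in_keys: "initial_mon f \<in> keys f"
    and less_initial_mon: "\<And>a. a \<in> keys f \<Longrightarrow> a \<noteq> initial_mon f \<Longrightarrow> revlex_less a (initial_mon f)"
proof -
  have "\<exists>m\<in>A. \<forall>a\<in>A. a \<noteq> m \<longrightarrow> revlex_less a m" if "finite A" "A \<noteq> {}" for A :: "'n mon set"
    using that
  proof (induction A rule: finite_ne_induct)
    case (insert x A)
    then obtain m where m: "m \<in> A" "\<forall>a\<in>A. a \<noteq> m \<longrightarrow> revlex_less a m" by blast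
    have "x \<noteq> m" using insert m by blast
    then consider "revlex_less x m" | "revlex_less m x" using revlex_less_total by blast
    then show ?case
    proof cases
      assume "revlex_less x m"
      then show ?thesis using m by blast
    next
      assume "revlex_less m x"
      then have "\<forall>a\<in>A. revlex_less a x" using m revlex_less_trans by metis
      then show ?thesis by blast
    qed
  qed simp
  from this[of "keys f"] obtain m where m: "m \<in> keys f" "\<forall>a\<in>keys f. a \<noteq> m \<longrightarrow> revlex_less a m"
    using assms by auto
  then have "initial_mon f = m" by (intro initial_mon_eqI) auto
  with m show "initial_mon f \<in> keys f"
    and "\<And>a. a \<in> keys f \<Longrightarrow> a \<noteq> initial_mon f \<Longrightarrow> revlex_less a (initial_mon f)" by auto
qed

lemma initial_mon_monom_mult:
  fixes f :: "('n::{finite,linorder}, 'k::field) mpoly"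
  assumes "f \<noteq> 0"
  shows "initial_mon (monom u * f) = u + initial_mon f"
  using initial_mon_greatest[OF assms] by (intro initial_mon_eqI) (auto simp: keys_monom_mult)

lemma initial_mon_diff:
  fixes f g :: "('n::{finite,linorder}, 'k::field) mpoly"
  assumes "f \<noteq> 0" "g \<noteq> 0" "initial_mon f = v" "initial_mon g = v" "lookup f v = lookup g v" "f - g \<noteq> 0"
  shows "revlex_less (initial_mon (f - g)) v"
proof -
  have a: "initial_mon (f - g) \<in> keys (f - g)" by (rule initial_mon_in_keys) fact
  then have "initial_mon (f - g) \<in> keys f \<or> initial_mon (f - g) \<in> keys g"
    by (auto simp: in_keys_iff lookup_minus)
  moreover have "initial_mon (f - g) \<noteq> v"
    using a assms(5) by (auto simp: in_keys_iff lookup_minus)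
  ultimately show ?thesis
    using less_initial_mon[OF assms(1)] less_initial_mon[OF assms(2)] assms(3,4) by metis
qed

definition initial_mons :: "('n::{finite,linorder}, 'k::field) mpoly set \<Rightarrow> 'n mon set" where
  "initial_mons V = {initial_mon f | f. f \<in> V \<and> f \<noteq> 0}"

definition monic_at :: "'n::{finite,linorder} mon \<Rightarrow> ('n, 'k::field) mpoly \<Rightarrow> bool" where
  "monic_at m f \<longleftrightarrow> initial_mon f = m \<and> lookup f m = 1"

lemma monic_at_nonzero: "monic_at m f \<Longrightarrow> f \<noteq> 0"
  by (auto simp: monic_at_def)

lemma monic_at_monom_mult: "monic_at m f \<Longrightarrow> monic_at (u + m) (monom u * f)"
  using monic_at_nonzero[of m f] by (simp add: monic_at_def initial_mon_monom_mult lookup_monom_mult)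

lemma exists_monic:
  assumes "mpoly.subspace V" "m \<in> initial_mons V"
  shows "\<exists>f\<in>V. monic_at m f"
proof -
  obtain f where f: "f \<in> V" "f \<noteq> 0" "m = initial_mon f"
    using assms(2) by (auto simp: initial_mons_def)
  define g where "g = mscale (inverse (lookup f m)) f"
  have "lookup f m \<noteq> 0" using f initial_mon_in_keys by (auto simp: in_keys_iff)
  then have k: "keys g = keys f" by (auto simp: g_def in_keys_iff)
  have "monic_at m g"
    unfolding monic_at_def
  proof
    show "initial_mon g = m"
      using k initial_mon_greatest[OF f(2)] f(3) by (intro initial_mon_eqI) auto
    show "lookup g m = 1" using \<open>lookup f m \<noteq> 0\<close> by (simp add: g_def)
  qed
  moreover have "g \<in> V" using assms(1) f(1) by (simp add: g_def mpoly.subspace_scale)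
  ultimately show ?thesis by blast
qed

lemma mdeg_initial_mons:
  assumes "m \<in> initial_mons (deg_part I e)"
  shows "mdeg m = e"
  using assms initial_mon_in_keys by (fastforce simp: initial_mons_def deg_part_def R_deg_def)

text \<open>
  A family with one monic element for each initial monomial is triangular, so it expands any
  element by subtracting leading terms, and only initial monomials up to that of the element
  can occur.
\<close>

lemma triangular_span:
  fixes V :: "('n::{finite,linorder}, 'k::field) mpoly set"
  assumes V: "mpoly.subspace V" "V \<subseteq> R_deg e"
    and b: "\<And>v. v \<in> initial_mons V \<Longrightarrow> b v \<in> V \<and> monic_at v (b v)"
    and f: "f \<in> V" "f \<noteq> 0"
  shows "f \<in> mpoly.span (b ` {v \<in> initial_mons V. v = initial_mon f \<or> revlex_less v (initial_mon f)})"
  using f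
proof (induction "below (initial_mon f)" arbitrary: f rule: less_induct)
  case less
  let ?B = "\<lambda>f. b ` {v \<in> initial_mons V. v = initial_mon f \<or> revlex_less v (initial_mon f)}"
  define v where "v = initial_mon f"
  define c where "c = lookup f v"
  define h where "h = mscale c (b v)"
  have v: "v \<in> initial_mons V" using less.prems by (auto simp: v_def initial_mons_def)
  have bv: "b v \<in> V" "monic_at v (b v)" using b[OF v] by auto
  have c: "c \<noteq> 0" using less.prems initial_mon_in_keys by (auto simp: c_def v_def in_keys_iff)
  then have k: "keys h = keys (b v)" by (auto simp: h_def in_keys_iff)
  have h: "h \<noteq> 0" "initial_mon h = v" "lookup h v = c"
  proof -
    show "lookup h v = c" using bv by (simp add: h_def monic_at_def)
    then show "h \<noteq> 0" using c by auto
    show "initial_mon h = v"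
      using k initial_mon_greatest[OF monic_at_nonzero[OF bv(2)]] bv(2)
      by (intro initial_mon_eqI) (auto simp: monic_at_def)
  qed
  have hB: "h \<in> mpoly.span (?B f)"
    unfolding h_def using v by (intro mpoly.span_scale mpoly.span_base) (auto simp: v_def)
  have g: "f - h \<in> V"
    using V(1) less.prems(1) bv(1) by (simp add: h_def mpoly.subspace_diff mpoly.subspace_scale)
  have "f - h \<in> mpoly.span (?B f)"
  proof (cases "f - h = 0")
    case True
    then show ?thesis by (simp only: mpoly.span_zero)
  next
    case False
    have lt: "revlex_less (initial_mon (f - h)) v"
      using less.prems(2) h False by (intro initial_mon_diff) (auto simp: v_def c_def)
    have "initial_mon (f - h) \<in> keys (f - h)" "v \<in> keys f"
      unfolding v_def by (intro initial_mon_in_keys False less.prems)+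
    then have "mdeg (initial_mon (f - h)) = mdeg v"
      using g less.prems(1) V(2) unfolding R_deg_def by (metis (mono_tags, lifting) mem_Collect_eq subsetD)
    then have "f - h \<in> mpoly.span (?B (f - h))"
      using less.hyps[OF _ g False] below_less[OF lt] by (simp add: v_def)
    moreover have "?B (f - h) \<subseteq> ?B f"
      using lt by (auto simp: v_def intro: revlex_less_trans)
    ultimately show ?thesis using mpoly.span_mono by blast
  qed
  from mpoly.span_add[OF this hB] show ?case by simp
qed

lemma initial_ideal_eq:
  "initial_ideal I = ideal.span (monom ` (\<Union>e. initial_mons (deg_part I e)))"
  unfolding initial_ideal_def initial_mons_def by (rule arg_cong[of _ _ ideal.span]) blast

text \<open>
  Multiples of elements of \<open>I\<close> are in \<open>I\<close>, so a monomial that is divisible by an initial monomial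
  is itself one.
\<close>

lemma monom_in_initial_ideal_iff:
  assumes "ideal.subspace I"
  shows "monom m \<in> initial_ideal I \<longleftrightarrow> m \<in> initial_mons (deg_part I (mdeg m))"
proof
  assume "m \<in> initial_mons (deg_part I (mdeg m))"
  then show "monom m \<in> initial_ideal I"
    unfolding initial_ideal_eq by (intro ideal.span_base) auto
next
  assume "monom m \<in> initial_ideal I"
  then obtain u a e where m: "m = u + a" "a \<in> initial_mons (deg_part I e)"
    unfolding initial_ideal_eq by (elim keys_in_monomial_ideal[of _ _ m]) auto
  then obtain f where f: "f \<in> deg_part I e" "f \<noteq> 0" "a = initial_mon f"
    by (auto simp: initial_mons_def)
  have "mdeg a = e" using m mdeg_initial_mons by blast
  then have "monom u * f \<in> deg_part I (mdeg m)"
    using monom_mult_deg_part[OF assms f(1), of u] m by simp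
  moreover have "monom u * f \<noteq> 0"
    using f(2) keys_monom_mult[of u f] by (metis image_is_empty keys_eq_empty)
  moreover have "initial_mon (monom u * f) = m"
    using f m by (simp add: initial_mon_monom_mult)
  ultimately show "m \<in> initial_mons (deg_part I (mdeg m))"
    unfolding initial_mons_def by blast
qed

section \<open>Rewriting products\<close>

text \<open>
  The pairs of the Eliahou--Kervaire decomposition, where no variable of \<open>u\<close> comes before a variable
  of \<open>m\<close>: the pairs that admit no swap.
\<close>

definition sorted_pairs :: "'n::{finite,linorder} mon set \<Rightarrow> nat \<Rightarrow> ('n mon \<times> 'n mon) set" where
  "sorted_pairs M k = {(u, m). mdeg u = k \<and> m \<in> M \<and> (\<forall>i\<in>keys u. \<forall>j\<in>keys m. j \<le> i)}"

text \<open>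
  If \<open>u m = u' m'\<close> with \<open>m \<noteq> m'\<close> of the same degree, some \<open>x\<^sub>i\<close> has a larger exponent in \<open>m'\<close> and some
  \<open>x\<^sub>j\<close> a larger exponent in \<open>m\<close>. Then \<open>x\<^sub>i\<close> divides \<open>u\<close> and \<open>x\<^sub>j\<close> divides \<open>u'\<close>, and sortedness of
  both pairs gives \<open>j \<le> i\<close> and \<open>i \<le> j\<close>.
\<close>

lemma inj_on_sorted_pairs:
  assumes "M \<subseteq> monomials d"
  shows "inj_on (\<lambda>(u, m). u + m) (sorted_pairs M k)"
proof (rule inj_onI, clarify)
  fix u m u' m'
  assume p: "(u, m) \<in> sorted_pairs M k" "(u', m') \<in> sorted_pairs M k" and eq: "u + m = u' + m'"
  have deg: "mdeg m = mdeg m'" using p assms by (auto simp: sorted_pairs_def monomials_def)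
  have eq': "lookup u l + lookup m l = lookup u' l + lookup m' l" for l
    using arg_cong[OF eq, of "\<lambda>p. lookup p l"] by (simp add: lookup_add)
  have "m = m'"
  proof (rule ccontr)
    assume ne: "m \<noteq> m'"
    have "\<exists>i. lookup m i < lookup m' i"
    proof (rule ccontr)
      assume "\<not> ?thesis"
      then have le: "lookup m' i \<le> lookup m i" for i by (simp add: not_less)
      moreover obtain i where "lookup m i \<noteq> lookup m' i" using ne by (auto intro: poly_mapping_eqI)
      ultimately have "mdeg m' < mdeg m"
        unfolding mdeg_def by (intro sum_strict_mono_ex1) (simp, simp, metis UNIV_I less_le)
      then show False using deg by simp
    qed
    then obtain i where i: "lookup m i < lookup m' i" by blast
    have "\<exists>j. lookup m' j < lookup m j"
    proof (rule ccontr)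
      assume "\<not> ?thesis"
      then have le: "lookup m j \<le> lookup m' j" for j by (simp add: not_less)
      then have "mdeg m < mdeg m'"
        unfolding mdeg_def using i by (intro sum_strict_mono_ex1) auto
      then show False using deg by simp
    qed
    then obtain j where j: "lookup m' j < lookup m j" by blast
    have "i \<in> keys u" "i \<in> keys m'" "j \<in> keys m" "j \<in> keys u'"
      using i j eq'[of i] eq'[of j] by (auto simp: in_keys_iff)
    then have "i = j" using p by (auto simp: sorted_pairs_def intro: antisym)
    then show False using i j by simp
  qed
  with eq show "u = u' \<and> m = m'" by simp
qed

text \<open>
  The rewriting of an unsorted product by a swap. The swapped product has the same product monomial
  and a larger second monomial, and the products in the error term have a smaller product monomial.
  So the induction is on the product monomial, and for equal product monomials on the second
  monomial in the reverse direction. The forms \<open>H v\<close> are not rewritten further.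
\<close>

lemma product_in_span_sorted:
  fixes I :: "('n::{finite,linorder}, 'k::field) mpoly set"
  assumes I: "ideal.subspace I"
    and M_def: "M = initial_mons (deg_part I d)"
    and N_def: "N = initial_mons (deg_part I (d + 1))"
    and Q_def: "Q = N - {var i + m | i m. m \<in> M}"
    and F: "\<And>m. m \<in> M \<Longrightarrow> F m \<in> deg_part I d \<and> monic_at m (F m)"
    and H: "\<And>v. v \<in> N \<Longrightarrow> H v \<in> deg_part I (d + 1) \<and> monic_at v (H v)"
    and stable: "\<And>m i j. m \<in> M \<Longrightarrow> j \<in> keys m \<Longrightarrow> i < j \<Longrightarrow> m + var i - var j \<in> M"
    and um: "mdeg u = k" "m \<in> M"
  shows "monom u * F m \<in> mpoly.span ((\<lambda>(u, m). monom u * F m) ` sorted_pairs M k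
           \<union> (\<lambda>(u, v). monom u * H v) ` (monomials (k - 1) \<times> Q))" (is "_ \<in> mpoly.span ?W")
  using um
proof (induction "(below (u + m), above m)" arbitrary: u m
    rule: wf_induct_rule[OF wf_lex_prod[OF wf_less_than wf_less_than]])
  case less: 1
  show ?case
  proof (cases "(u, m) \<in> sorted_pairs M k")
    case True
    then show ?thesis by (intro mpoly.span_base) auto
  next
    case False
    then obtain i j where ij: "i \<in> keys u" "j \<in> keys m" "i < j"
      using less.prems by (auto simp: sorted_pairs_def not_le)
    define u0 where "u0 = u - var i"
    define m' where "m' = m + var i - var j"
    have u: "u = u0 + var i" unfolding u0_def by (rule var_plus_minus_var[OF ij(1), symmetric])
    have m': "m' \<in> M" unfolding m'_def using stable less.prems(2) ij by blast
    have degM: "mdeg x = d" if "x \<in> M" for x using that by (simp add: M_def mdeg_initial_mons)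
    have swap: "var j + m' = var i + m"
    proof -
      have "j \<in> keys (m + var i)" using ij(2) by (simp add: in_keys_iff lookup_add)
      from var_plus_minus_var[OF this] show ?thesis by (simp add: m'_def ac_simps)
    qed
    have degu0: "mdeg u0 = k - 1" "k \<ge> 1" using u less.prems(1) by auto
    have first: "monom (u0 + var j) * F m' \<in> mpoly.span ?W"
    proof (rule less.hyps)
      have "u0 + var j + m' = u + m" using swap u by (simp add: add.assoc)
      moreover have "above m' < above m"
        using revlex_less_shift[OF ij(3,2)] degM m' less.prems(2)
        by (intro above_less) (auto simp: m'_def)
      ultimately show "((below (u0 + var j + m'), above m'), below (u + m), above m)
          \<in> less_than <*lex*> less_than" by simp
      show "mdeg (u0 + var j) = k" using degu0 by simp
    qed fact
    define g where "g = monom (var i) * F m - monom (var j) * F m'"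
    define V where "V = deg_part I (d + 1)"
    have V: "mpoly.subspace V" "V \<subseteq> R_deg (d + 1)"
      using subspace_deg_part[OF I] by (auto simp: V_def deg_part_def)
    have pV: "monom (var l) * F x \<in> V" "monic_at (var l + x) (monom (var l) * F x)" if "x \<in> M" for l x
      using F[OF that] monom_mult_deg_part[OF I, of "F x" d "var l"]
      by (auto simp: V_def intro: monic_at_monom_mult)
    have gV: "g \<in> V"
      unfolding g_def using pV less.prems(2) m' V(1) by (intro mpoly.subspace_diff)
    \<comment> \<open>A triangular family in degree \<open>d + 1\<close> that uses \<open>H\<close> only where no product has the initial
      monomial \<open>v\<close>. Any factorization \<open>v = x\<^sub>l x\<close> will do, sorted or not.\<close>
    define b where "b v = (if v \<in> Q then H v
      else let (l, x) = (SOME (l, x). x \<in> M \<and> v = var l + x) in monom (var l) * F x)" for v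
    have b: "v \<in> Q \<and> b v = H v \<or> (\<exists>l x. x \<in> M \<and> v = var l + x \<and> b v = monom (var l) * F x)"
      if "v \<in> N" for v
    proof (cases "v \<in> Q")
      case False
      then have "\<exists>p. case p of (l, x) \<Rightarrow> x \<in> M \<and> v = var l + x" using that by (auto simp: Q_def)
      from someI_ex[OF this] show ?thesis using False by (auto simp: b_def split: prod.splits)
    qed (simp add: b_def)
    have "monom u0 * g \<in> mpoly.span ?W"
    proof (cases "g = 0")
      case True
      then show ?thesis by (simp add: mpoly.span_zero)
    next
      case False
      have lt: "revlex_less (initial_mon g) (var i + m)"
        unfolding g_def
        using False pV(2)[OF less.prems(2), of i] pV(2)[OF m', of j] swap
        by (intro initial_mon_diff) (auto simp: monic_at_def g_def)
      have "g \<in> mpoly.span (b ` {v \<in> initial_mons V. v = initial_mon g \<or> revlex_less v (initial_mon g)})"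
      proof (rule triangular_span[OF V _ gV False])
        fix v assume "v \<in> initial_mons V"
        then have "v \<in> N" by (simp add: N_def V_def)
        with b[OF this] H[OF this] pV show "b v \<in> V \<and> monic_at v (b v)" by (auto simp: V_def)
      qed
      then show ?thesis
      proof (rule mult_span)
        fix y assume "y \<in> b ` {v \<in> initial_mons V. v = initial_mon g \<or> revlex_less v (initial_mon g)}"
        then obtain v where v: "y = b v" "v \<in> N" "revlex_less v (var i + m)"
          using lt by (auto simp: N_def V_def intro: revlex_less_trans)
        from b[OF v(2)] show "monom u0 * y \<in> mpoly.span ?W"
        proof (elim disjE exE conjE)
          assume "v \<in> Q" "b v = H v"
          then show ?thesis using v(1) degu0 by (intro mpoly.span_base) (auto simp: monomials_def)
        next
          fix l x assume x: "x \<in> M" "v = var l + x" "b v = monom (var l) * F x"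
          have "monom (u0 + var l) * F x \<in> mpoly.span ?W"
          proof (rule less.hyps)
            have "revlex_less (u0 + v) (u0 + (var i + m))" using v(3) by simp
            then have "below (u0 + var l + x) < below (u + m)"
              using degM[OF x(1)] degM[OF less.prems(2)]
              by (intro below_less) (simp_all add: x(2) u add.assoc)
            then show "((below (u0 + var l + x), above x), below (u + m), above m)
              \<in> less_than <*lex*> less_than" by simp
            show "mdeg (u0 + var l) = k" using degu0 by simp
          qed fact
          then show ?thesis using v(1) x(3) by (simp add: mult_single flip: mult.assoc)
        qed
      qed
    qed
    moreover have "monom u * F m = monom (u0 + var j) * F m' + monom u0 * g"
      unfolding u g_def by (simp add: right_diff_distrib mult_single flip: mult.assoc)
    ultimately show ?thesis using first by (simp add: mpoly.span_add)
  qed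
qed

section \<open>The bound\<close>

text \<open>Every monomial of an element of a monomial ideal is in the ideal, so monomials suffice.\<close>

lemma dim_products_monomial_ideal:
  fixes J :: "('n::finite, 'k::field) mpoly set"
  assumes "J = ideal.span (monom ` A)"
  shows "mpoly.dim (mpoly.span {f * g | f g. f \<in> R_deg k \<and> g \<in> deg_part J d})
    = card {u + m | u m. mdeg u = k \<and> mdeg m = d \<and> monom m \<in> J}" (is "mpoly.dim (mpoly.span ?P) = card ?A")
proof -
  have "?P \<subseteq> mpoly.span (monom ` ?A)"
  proof (clarsimp simp: span_monom)
    fix f g :: "('n, 'k) mpoly" and w
    assume fg: "f \<in> R_deg k" "g \<in> deg_part J d" "w \<in> keys (f * g)"
    then obtain u m where um: "w = u + m" "u \<in> keys f" "m \<in> keys g" using keys_mult by blast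
    have "g \<in> ideal.span (monom ` A)" using fg assms by (simp add: deg_part_def)
    then obtain v a where "a \<in> A" "m = v + a" using um(3) by (rule keys_in_monomial_ideal)
    then have "monom m = monom v * (monom a :: ('n, 'k) mpoly)" by (simp add: mult_single)
    then have "(monom m :: ('n, 'k) mpoly) \<in> J"
      unfolding assms using \<open>a \<in> A\<close> by (simp add: ideal.span_scale ideal.span_base)
    then show "\<exists>u m. w = u + m \<and> mdeg u = k \<and> mdeg m = d \<and> monom m \<in> J"
      using um fg by (auto simp: R_deg_def deg_part_def)
  qed
  moreover have "monom ` ?A \<subseteq> ?P"
  proof clarify
    fix u m :: "'n mon"
    assume "(monom m :: ('n, 'k) mpoly) \<in> J" 
    then have "(monom u :: ('n, 'k) mpoly) \<in> R_deg (mdeg u)" "(monom m :: ('n, 'k) mpoly) \<in> deg_part J (mdeg m)"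
      by (auto simp: R_deg_def deg_part_def)
    then show "\<exists>f g. (monom (u + m) :: ('n, 'k) mpoly) = f * g \<and> f \<in> R_deg (mdeg u) \<and> g \<in> deg_part J (mdeg m)"
      by (intro exI[of _ "monom u"] exI[of _ "monom m"]) (simp add: mult_single)
  qed
  ultimately have "mpoly.span ?P = mpoly.span (monom ` ?A)"
    unfolding mpoly.span_eq using mpoly.span_superset[of ?P] by blast
  then show ?thesis by (simp only: dim_span_monom)
qed

theorem theorem1p13:
  fixes I :: "('n::{finite,linorder}, 'k::field_char_0) mpoly set"
    and G :: "'n mon set"
    and d q k :: nat
  assumes "CARD('n) \<ge> 3"
    and "ideal.subspace I" and "homogeneous_ideal I"
    and "generated_in_degrees_le d I"
    and "strongly_stable (initial_ideal I)"
    and "minimal_generators (initial_ideal I) G"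
    and "card {m \<in> G. mdeg m = d + 1} = q"
    and "k \<ge> 1"
  shows "mpoly.dim (deg_part I (d + k))
    \<le> q * ((CARD('n) - 1 + k - 1) choose (CARD('n) - 1))
      + mpoly.dim (mpoly.span {f * g | f g. f \<in> R_deg k \<and> g \<in> deg_part (initial_ideal I) d})"
proof -
  note I = assms(2)
  define J where "J = initial_ideal I"
  define M where "M = initial_mons (deg_part I d)"
  define N where "N = initial_mons (deg_part I (d + 1))"
  define Q where "Q = N - {var i + m | i m. m \<in> M}"
  define A where "A = {u + m | u m. mdeg u = k \<and> mdeg m = d \<and> monom m \<in> J}"
  have M: "m \<in> M \<longleftrightarrow> mdeg m = d \<and> monom m \<in> J" for m
    unfolding M_def J_def monom_in_initial_ideal_iff[OF I] using mdeg_initial_mons by blast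
  have N: "m \<in> N \<longleftrightarrow> mdeg m = d + 1 \<and> monom m \<in> J" for m
    unfolding N_def J_def monom_in_initial_ideal_iff[OF I] by (metis mdeg_initial_mons)
  have G: "J = ideal.span (monom ` G)"
    using assms(6) by (simp add: J_def minimal_generators_def)

  have "finite {m \<in> G. mdeg m = d + 1}"
    by (rule finite_subset[OF _ finite_monomials[of "d + 1"]]) (auto simp: monomials_def)
  \<comment> \<open>Generators of lower degree that divide \<open>v \<in> Q\<close> are excluded by the choice of \<open>Q\<close>, so \<open>v\<close> is
    itself a generator.\<close>
  moreover have "Q \<subseteq> {m \<in> G. mdeg m = d + 1}"
  proof
    fix v assume "v \<in> Q"
    then have v: "mdeg v = d + 1" "monom v \<in> J" "\<And>i m. m \<in> M \<Longrightarrow> v \<noteq> var i + m"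
      by (auto simp: Q_def N)
    then obtain u a where a: "a \<in> G" "v = u + a"
      unfolding G by (elim keys_in_monomial_ideal[of _ _ v]) auto
    have "u = 0"
    proof (rule ccontr)
      assume "u \<noteq> 0"
      then obtain i where i: "i \<in> keys u" by fastforce
      define m where "m = (u - var i) + a"
      have vm: "v = var i + m"
        using var_plus_minus_var[OF i] a(2) by (simp add: m_def ac_simps)
      have "monom m = monom (u - var i) * (monom a :: ('n, 'k) mpoly)"
        by (simp add: m_def mult_single)
      then have "(monom m :: ('n, 'k) mpoly) \<in> J"
        unfolding G using a(1) by (simp add: ideal.span_scale ideal.span_base)
      then have "m \<in> M" using v(1) vm by (simp add: M)
      then show False using v(3) vm by blast
    qed
    then show "v \<in> {m \<in> G. mdeg m = d + 1}" using a v(1) by simp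
  qed
  ultimately have Q: "finite Q" "card Q \<le> q"
    using assms(7) finite_subset card_mono by blast+

  have "\<exists>F. \<forall>m\<in>M. F m \<in> deg_part I d \<and> monic_at m (F m)"
    unfolding M_def by (intro bchoice ballI) (use exists_monic[OF subspace_deg_part[OF I]] in blast)
  then obtain F where F: "\<And>m. m \<in> M \<Longrightarrow> F m \<in> deg_part I d \<and> monic_at m (F m)" by blast
  have "\<exists>H. \<forall>v\<in>N. H v \<in> deg_part I (d + 1) \<and> monic_at v (H v)"
    unfolding N_def by (intro bchoice ballI) (use exists_monic[OF subspace_deg_part[OF I]] in blast)
  then obtain H where H: "\<And>v. v \<in> N \<Longrightarrow> H v \<in> deg_part I (d + 1) \<and> monic_at v (H v)" by blast
  have stable: "m + var i - var j \<in> M" if "m \<in> M" "j \<in> keys m" "i < j" for m i j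
  proof -
    have "monom (m + var i - var j) \<in> J"
      using assms(5) that unfolding strongly_stable_def J_def[symmetric]
      by (auto simp: M in_keys_iff)
    moreover have "j \<in> keys (m + var i)" using that by (simp add: in_keys_iff lookup_add)
    from arg_cong[OF var_plus_minus_var[OF this], of mdeg] have "mdeg (m + var i - var j) = d"
      using that(1) by (simp add: M)
    ultimately show ?thesis by (simp add: M)
  qed

  let ?W1 = "(\<lambda>(u, m). monom u * F m) ` sorted_pairs M k"
  let ?W2 = "(\<lambda>(u, v). monom u * H v) ` (monomials (k - 1) \<times> Q)"
  have fA: "finite A"
    by (rule finite_subset[OF _ finite_monomials[of "k + d"]]) (auto simp: A_def monomials_def)
  have inj: "inj_on (\<lambda>(u, m). u + m) (sorted_pairs M k)"
    by (rule inj_on_sorted_pairs[of _ d]) (auto simp: M monomials_def)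
  have im: "(\<lambda>(u, m). u + m) ` sorted_pairs M k \<subseteq> A"
    by (auto simp: A_def sorted_pairs_def M)
  have fin: "finite (sorted_pairs M k)" using inj im fA by (rule inj_on_finite)
  have W1: "finite ?W1" "card ?W1 \<le> card A"
    using fin card_image_le[OF fin] card_inj_on_le[OF inj im fA] by (auto intro: order_trans)
  have "card ?W2 \<le> card ((monomials (k - 1) :: 'n mon set) \<times> Q)"
    by (rule card_image_le) (simp add: Q(1))
  also have "\<dots> = card (monomials (k - 1) :: 'n mon set) * card Q" by (rule card_cartesian_product)
  also have "\<dots> \<le> ((k - 1 + CARD('n) - 1) choose (k - 1)) * q"
    using Q card_monomials_le by (intro mult_mono) auto
  also have "(k - 1 + CARD('n) - 1) choose (k - 1) = (CARD('n) - 1 + k - 1) choose (CARD('n) - 1)"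
    using assms(1,8) binomial_symmetric[of "k - 1" "k - 1 + CARD('n) - 1"] by (simp add: add.commute)
  finally have W2: "card ?W2 \<le> q * ((CARD('n) - 1 + k - 1) choose (CARD('n) - 1))"
    by (simp add: mult.commute)

  have prod: "monom u * F m \<in> mpoly.span (?W1 \<union> ?W2)" if "mdeg u = k" "m \<in> M" for u m
    using product_in_span_sorted[OF I M_def N_def Q_def F H stable that] by blast
  have "{monom u * g | u g. mdeg u = k \<and> g \<in> deg_part I d} \<subseteq> mpoly.span (?W1 \<union> ?W2)"
  proof
    fix f assume "f \<in> {monom u * g | u g. mdeg u = k \<and> g \<in> deg_part I d}"
    then obtain u g where g: "mdeg u = k" "g \<in> deg_part I d" "f = monom u * g" by blast
    have "g \<in> mpoly.span (F ` M)"
    proof (cases "g = 0")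
      case True
      then show ?thesis by (simp add: mpoly.span_zero)
    next
      case False
      have "g \<in> mpoly.span (F ` {v \<in> initial_mons (deg_part I d). v = initial_mon g \<or> revlex_less v (initial_mon g)})"
        using F g False subspace_deg_part[OF I]
        by (intro triangular_span[of _ d]) (auto simp: M_def deg_part_def)
      moreover have "F ` {v \<in> initial_mons (deg_part I d). v = initial_mon g \<or> revlex_less v (initial_mon g)} \<subseteq> F ` M"
        by (auto simp: M_def)
      ultimately show ?thesis using mpoly.span_mono by blast
    qed
    then show "f \<in> mpoly.span (?W1 \<union> ?W2)"
      unfolding g(3) by (rule mult_span) (use prod g(1) in blast)
  qed
  then have "deg_part I (d + k) \<subseteq> mpoly.span (?W1 \<union> ?W2)"
    using deg_part_generated[OF assms(4)] mpoly.span_minimal[OF _ mpoly.subspace_span] by blast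
  then have "mpoly.dim (deg_part I (d + k)) \<le> card (?W1 \<union> ?W2)"
    using W1(1) Q(1) by (intro mpoly.dim_le_card) auto
  also have "\<dots> \<le> card ?W1 + card ?W2" by (rule card_Un_le)
  also have "\<dots> \<le> q * ((CARD('n) - 1 + k - 1) choose (CARD('n) - 1)) + card A"
    using W1(2) W2 by simp
  also have "card A = mpoly.dim (mpoly.span {f * g | f g. f \<in> R_deg k \<and> g \<in> deg_part (initial_ideal I) d})"
    unfolding J_def[symmetric] A_def by (rule dim_products_monomial_ideal[OF G, symmetric])
  finally show ?thesis .
qed

end
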